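(* Let $d:\mathbb{R}\to\mathbb{R}$ be an additive function and let $\alpha,\beta\in\mathbb{R}$ with $\alpha<\beta$. Suppose that $d$ is a derivation with respect to the restriction to the open interval $(\alpha,\beta)$ of any one of the following functions, with the corresponding further assumption on $\alpha$ and $\beta$: (i) $\exp$, where $2\alpha<\beta$ and $\alpha<2\beta$; (ii) $\sinh$, where $\alpha<0<\beta$; (iii) $\cosh$, where $0<2\alpha<\beta$ or $\alpha<2\beta<0$; (iv) $\tanh$, where $\alpha<0<\beta$; (v) $\coth$, where $0<2\alpha<\beta$ or $\alpha<2\beta<0$; (vi) $\sin$, where $\alpha<0<\beta$; (vii) $\cos$, where $0<2\alpha<\pi<\beta$ or $\alpha<-\pi<2\beta<0$; (viii) $\tan$, where $-\pi<2\alpha<\beta$ and $\alpha<2\beta<\pi$; (ix) $\cot$, where $0<2\alpha<\beta<\pi$ or $-\pi<\alpha<2\beta<0$. Then $d$ is a standard derivation.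
   Context: A function $d:\mathbb{R}\to\mathbb{R}$ is additive if $d(x+y)=d(x)+d(y)$ for all $x,y\in\mathbb{R}$. It is a standard derivation if it is additive and satisfies $d(xy)=d(x)y+x\,d(y)$ for all $x,y\in\mathbb{R}$. For a differentiable function $f:I\to\mathbb{R}$ on a nonempty open interval $I$, $d$ is called a derivation with respect to $f$ if $d(f(x))=f'(x)\,d(x)$ for all $x\in I$. *)

theory Defs
  imports "HOL-Analysis.Analysis"
begin

(* The qualified name is needed: HOL-Analysis also has an unrelated set-function notion "additive". *)
definition standard_derivation :: "(real \<Rightarrow> real) \<Rightarrow> bool" where
  "standard_derivation d \<longleftrightarrow>
     Modules.additive d \<and> (\<forall>x y. d (x * y) = d x * y + x * d y)"

(* A function I -> R is represented by a total f of which only the values on I matter: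
   since I is open, differentiability on I and deriv at points of I depend only on f restricted to I. *)
definition derivation_wrt :: "(real \<Rightarrow> real) \<Rightarrow> (real \<Rightarrow> real) \<Rightarrow> real set \<Rightarrow> bool" where
  "derivation_wrt d f I \<longleftrightarrow>
     I \<noteq> {} \<and> open I \<and> is_interval I \<and> f differentiable_on I \<and>
     (\<forall>x\<in>I. d (f x) = deriv f x * d x)"

definition coth :: "real \<Rightarrow> real" where
  "coth x = cosh x / sinh x"

end

theory Submission
  imports Defs
begin

text \<open>
  Write \<open>\<sigma> = 1\<close> in the hyperbolic and \<open>\<sigma> = -1\<close> in the circular cases.
  An additive \<open>d\<close> is homogeneous over the rationals, so an identity that is compatible with
  rational scaling and holds on some nonempty open interval, however short, holds everywhere except
  perhaps at 0. By such arguments each of the rules \<open>d (u\<^sup>2) = 2 u d u\<close>, \<open>d (u\<^sup>3) = 3 u\<^sup>2 d u\<close> and \<open>d (1 / u) = - d u / u\<^sup>2\<close>,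
  known on an interval only, already makes \<open>d\<close> a standard derivation
  (\<open>standard_derivation_if_square_rule\<close>, \<open>standard_derivation_if_cube_rule\<close>,
  \<open>standard_derivation_if_reciprocal_rule\<close>). It remains to extract one of these rules from the
  addition theorem of the given function \<open>f\<close>.

  The mechanism is \<open>derivation_rule_transfer\<close>: if \<open>f (k x + c) = \<phi> (f x)\<close> with \<open>k\<close> rational and
  \<open>d c = 0\<close>, then the chain rule turns the rule for \<open>f\<close> at \<open>x\<close> and at \<open>k x + c\<close> into
  \<open>d (\<phi> u) = \<phi>' u * d u\<close> at \<open>u = f x\<close>, an identity in which \<open>f\<close> no longer occurs. The assumptions on
  the end points guarantee that \<open>x\<close> and \<open>k x + c\<close> both lie in \<open>(\<alpha>, \<beta>)\<close> for all \<open>x\<close> in some smaller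
  interval.

  \<^item> For \<open>exp\<close>, \<open>cosh\<close> and \<open>cos\<close>, doubling of \<open>x\<close> acts by a quadratic polynomial \<open>\<phi>\<close> without linear
    term: this is the square rule up to a constant, which is harmless.
  \<^item> For \<open>coth\<close> and \<open>cot\<close>, doubling acts by \<open>\<phi> u = (u + \<sigma> / u) / 2\<close>: this is the reciprocal rule.
  \<^item> For \<open>sinh\<close> and \<open>sin\<close>, doubling does not act rationally, but tripling does, by
    \<open>\<phi> u = 3 u + 4 \<sigma> u\<^sup>3\<close>: this is the cube rule.
  \<^item> For \<open>tanh\<close> and \<open>tan\<close>, the doubling formula at a point where \<open>f\<close> is rational gives \<open>d 1 = 0\<close>, so
    \<open>d\<close> vanishes on the rationals, and then \<open>d y = 0\<close> whenever \<open>q = f y\<close> is rational. Translation by such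
    a \<open>y\<close> acts on \<open>u\<close> as the homography \<open>(u + q) / (1 + \<sigma> q u)\<close>. Up to rational constants this is the
    reciprocal of \<open>1 + \<sigma> q u\<close>, and the reciprocal rule follows.
\<close>

section \<open>Additive functions and rules on an interval\<close>

lemma additive_rat_mult:
  fixes d :: "real \<Rightarrow> real"
  assumes "Modules.additive d" "r \<in> \<rat>"
  shows "d (r * x) = r * d x"
proof -
  interpret additive d by fact
  have nat_mult: "d (of_nat n * y) = of_nat n * d y" for n y
    by (induction n) (simp_all add: zero add distrib_right)
  have int_mult: "d (of_int n * y) = of_int n * d y" for n y
    by (cases n rule: int_cases2) (simp_all add: nat_mult minus)
  obtain m n where mn: "n > 0" "r = of_int m / of_int n"
    using Rats_cases'[OF \<open>r \<in> \<rat>\<close>] by metis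
  have "of_int n * d (r * x) = d (of_int n * (r * x))"
    by (simp only: int_mult)
  also have "\<dots> = d (of_int m * x)"
    using mn by simp
  finally have "of_int n * d (r * x) = of_int m * d x"
    by (simp only: int_mult)
  also have "\<dots> = of_int n * (r * d x)"
    using mn by simp
  finally show ?thesis
    using mn(1) by simp
qed

lemma additive_rat_divide:
  fixes d :: "real \<Rightarrow> real"
  assumes "Modules.additive d" "r \<in> \<rat>"
  shows "d (x / r) = d x / r"
  using additive_rat_mult[OF assms(1) Rats_inverse[OF assms(2)], of x]
  by (simp add: field_simps)

lemma additive_Rats_eq_zero:
  fixes d :: "real \<Rightarrow> real"
  assumes "Modules.additive d" "d 1 = 0" "r \<in> \<rat>"
  shows "d r = 0"
  using additive_rat_mult[OF assms(1,3), of 1] assms(2) by simp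

lemma exists_nonzero_rat_between:
  fixes p q :: real
  assumes "p < q"
  obtains r where "r \<in> \<rat>" "r \<noteq> 0" "r \<in> {p<..<q}"
proof (cases "q > 0")
  case True
  then show ?thesis
    using Rats_dense_in_real[of "max p 0" q] assms that by force
next
  case False
  then show ?thesis
    using Rats_dense_in_real[of p q] assms that by force
qed

lemma exists_nonzero_rat_mult_between:
  fixes p q w :: real
  assumes "p < q" "w \<noteq> 0"
  obtains r where "r \<in> \<rat>" "r \<noteq> 0" "r * w \<in> {p<..<q}"
proof -
  have "p / w \<noteq> q / w"
    using assms by simp
  then have "min (p / w) (q / w) < max (p / w) (q / w)"
    by linarith
  then obtain r where r: "r \<in> \<rat>" "r \<noteq> 0" "r \<in> {min (p / w) (q / w)<..<max (p / w) (q / w)}"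
    using exists_nonzero_rat_between by blast
  have "r * w \<in> {p<..<q}"
    using r(3) assms
    by (cases "w > 0") (auto simp: min_def max_def field_simps split: if_splits)
  with r(1,2) that show ?thesis by blast
qed

lemma standard_derivation_if_global_square_rule:
  assumes "Modules.additive d" "\<And>w. d (w\<^sup>2) = 2 * w * d w"
  shows "standard_derivation d"
proof -
  interpret additive d by fact
  have "d (x * y) = d x * y + x * d y" for x y
  proof -
    have "(x + y)\<^sup>2 = x\<^sup>2 + y\<^sup>2 + (x * y + x * y)"
      by (simp add: power2_eq_square algebra_simps)
    then have "d ((x + y)\<^sup>2) = d (x\<^sup>2) + d (y\<^sup>2) + (d (x * y) + d (x * y))"
      by (metis add)
    then show ?thesis
      unfolding assms(2) by (simp add: add algebra_simps)
  qed
  with assms(1) show ?thesis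
    unfolding standard_derivation_def by blast
qed

text \<open>The second difference of \<open>u \<mapsto> u\<^sup>2\<close> with step \<open>h\<close> is \<open>2 h\<^sup>2\<close>, whatever the base point.
  Hence the rule passes from the interval to all small \<open>h\<close>, and thence by rational scaling to all reals.
  Taking differences also removes the constant \<open>c\<close>.\<close>

lemma standard_derivation_if_square_rule:
  assumes d_additive: "Modules.additive d" and "p < q"
    and square: "\<And>u. u \<in> {p<..<q} \<Longrightarrow> d (u\<^sup>2) = 2 * u * d u + c"
  shows "standard_derivation d"
proof (rule standard_derivation_if_global_square_rule[OF d_additive])
  interpret additive d by fact
  fix w
  show "d (w\<^sup>2) = 2 * w * d w"
  proof (cases "w = 0")
    case False
    define u where "u = (p + q) / 2"
    have "- ((q - p) / 2) < (q - p) / 2"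
      using \<open>p < q\<close> by (simp add: field_simps)
    then obtain r where r: "r \<in> \<rat>" "r \<noteq> 0" "r * w \<in> {- ((q - p) / 2)<..<(q - p) / 2}"
      by (rule exists_nonzero_rat_mult_between[OF _ False])
    define h where "h = r * w"
    have "u \<in> {p<..<q}" "u + h \<in> {p<..<q}" "u - h \<in> {p<..<q}"
      using r \<open>p < q\<close> unfolding u_def h_def by (auto simp: abs_less_iff field_simps)
    then have sq: "d (u\<^sup>2) = 2 * u * d u + c" "d ((u + h)\<^sup>2) = 2 * (u + h) * (d u + d h) + c"
        "d ((u - h)\<^sup>2) = 2 * (u - h) * (d u - d h) + c"
      using square by (simp_all add: add diff)
    have "(u + h)\<^sup>2 + (u - h)\<^sup>2 = u\<^sup>2 + u\<^sup>2 + (h\<^sup>2 + h\<^sup>2)"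
      by (simp add: power2_eq_square algebra_simps)
    then have "d ((u + h)\<^sup>2) + d ((u - h)\<^sup>2) = d (u\<^sup>2) + d (u\<^sup>2) + (d (h\<^sup>2) + d (h\<^sup>2))"
      by (metis add)
    then have "d (h\<^sup>2) = 2 * h * d h"
      unfolding sq by (simp add: algebra_simps)
    moreover have hw: "d (h\<^sup>2) = r\<^sup>2 * d (w\<^sup>2)" "d h = r * d w"
      unfolding h_def power_mult_distrib using r
      by (simp_all add: additive_rat_mult[OF d_additive])
    ultimately have "r\<^sup>2 * d (w\<^sup>2) = 2 * h * (r * d w)"
      by simp
    also have "\<dots> = r\<^sup>2 * (2 * w * d w)"
      by (simp add: h_def power2_eq_square)
    finally have "r\<^sup>2 * d (w\<^sup>2) = r\<^sup>2 * (2 * w * d w)" .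
    with r(2) show ?thesis by simp
  qed (simp add: zero)
qed

text \<open>The cube rule is invariant under rational scaling, so it holds on all of \<open>\<real>\<close>. The
  square rule then comes from \<open>(u + 1)\<^sup>3 - (u - 1)\<^sup>3 = 6 u\<^sup>2 + 2\<close>.\<close>

lemma standard_derivation_if_cube_rule:
  assumes d_additive: "Modules.additive d" and "p < q"
    and cube: "\<And>u. u \<in> {p<..<q} \<Longrightarrow> d (u^3) = 3 * u\<^sup>2 * d u"
  shows "standard_derivation d"
proof -
  interpret additive d by fact
  have cub: "d (w^3) = 3 * w\<^sup>2 * d w" for w
  proof (cases "w = 0")
    case False
    obtain r where r: "r \<in> \<rat>" "r \<noteq> 0" "r * w \<in> {p<..<q}"
      using exists_nonzero_rat_mult_between[OF \<open>p < q\<close> False] .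
    have "r^3 * d (w^3) = 3 * (r * w)\<^sup>2 * (r * d w)"
      using cube[OF r(3)] r(1) by (simp add: power_mult_distrib additive_rat_mult[OF d_additive])
    also have "\<dots> = r^3 * (3 * w\<^sup>2 * d w)"
      by (simp add: power2_eq_square power3_eq_cube)
    finally show ?thesis
      using r(2) by simp
  qed (simp add: zero)
  have one: "d 1 = 0"
    using cub[of 1] by simp
  show ?thesis
  proof (rule standard_derivation_if_global_square_rule[OF d_additive])
    fix u :: real
    have "(u + 1)^3 = (u - 1)^3 + (6 * u\<^sup>2 + 2)"
      by (simp add: power2_eq_square power3_eq_cube algebra_simps)
    then have "d ((u + 1)^3) = d ((u - 1)^3) + (d (6 * u\<^sup>2) + d 2)"
      by (metis add)
    then have "3 * (u + 1)\<^sup>2 * d u = 3 * (u - 1)\<^sup>2 * d u + 6 * d (u\<^sup>2)"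
      unfolding cub
      by (simp add: add diff one additive_rat_mult[OF d_additive]
          additive_Rats_eq_zero[OF d_additive one])
    then show "d (u\<^sup>2) = 2 * u * d u"
      by (simp add: power2_eq_square algebra_simps)
  qed
qed

text \<open>The reciprocal rule is invariant under rational scaling, so it holds at all nonzero reals. The
  square rule then comes from \<open>1 / u - 1 / (u + 1) = 1 / (u\<^sup>2 + u)\<close>.\<close>

lemma standard_derivation_if_reciprocal_rule:
  assumes d_additive: "Modules.additive d" and "p < q"
    and recip: "\<And>u. u \<in> {p<..<q} \<Longrightarrow> u \<noteq> 0 \<and> d (1 / u) = - d u / u\<^sup>2"
  shows "standard_derivation d"
proof -
  interpret additive d by fact
  have rec: "d (1 / w) = - d w / w\<^sup>2" if "w \<noteq> 0" for w
  proof -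
    obtain r where r: "r \<in> \<rat>" "r \<noteq> 0" "r * w \<in> {p<..<q}"
      using exists_nonzero_rat_mult_between[OF \<open>p < q\<close> \<open>w \<noteq> 0\<close>] .
    have "d (1 / (r * w)) = - (r * d w) / (r * w)\<^sup>2"
      using recip[OF r(3)] additive_rat_mult[OF d_additive r(1)] by auto
    moreover have "d (1 / (r * w)) = d (1 / w) / r"
      using additive_rat_divide[OF d_additive r(1), of "1 / w"] by (simp add: mult.commute)
    ultimately show ?thesis
      using that r(2) by (simp add: field_simps power2_eq_square)
  qed
  show ?thesis
  proof (rule standard_derivation_if_square_rule[OF d_additive, of 0 1])
    fix u :: real
    \<comment> \<open>any interval will do on which neither \<open>u\<close> nor \<open>u + 1\<close> vanishes\<close>
    assume "u \<in> {0<..<1}"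
    then have u: "u \<noteq> 0" "u + 1 \<noteq> 0" "u\<^sup>2 + u \<noteq> 0"
      by (auto simp: add_pos_pos order.strict_implies_not_eq[symmetric])
    have one: "d 1 = 0"
      using rec[of 1] by simp
    have factor: "u\<^sup>2 + u = u * (u + 1)"
      by (simp add: power2_eq_square algebra_simps)
    have "1 / u = 1 / (u + 1) + 1 / (u\<^sup>2 + u)"
      unfolding factor using u(1,2) by (simp add: divide_simps)
    then have "d (1 / u) = d (1 / (u + 1)) + d (1 / (u\<^sup>2 + u))"
      by (metis add)
    then have "- d u / u\<^sup>2 = - d u / (u + 1)\<^sup>2 + (- d (u\<^sup>2) - d u) / (u\<^sup>2 + u)\<^sup>2"
      unfolding rec[OF u(1)] rec[OF u(2)] rec[OF u(3)] by (simp add: add one)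
    then have "- d u * (u + 1)\<^sup>2 = - d u * u\<^sup>2 - (d (u\<^sup>2) + d u)"
      unfolding factor using u(1,2) by (simp add: power_mult_distrib divide_simps split: if_splits)
    then show "d (u\<^sup>2) = 2 * u * d u + 0"
      by (simp add: power2_eq_square algebra_simps)
  qed simp
qed

section \<open>Rules transferred along functional equations\<close>

lemma derivation_wrtD:
  assumes "derivation_wrt d f I" "x \<in> I" "(f has_real_derivative D) (at x)"
  shows "d (f x) = D * d x"
  using assms unfolding derivation_wrt_def by (metis DERIV_imp_deriv)

text \<open>By the chain rule \<open>k * f' (k * x + c) = \<phi>' (f x) * f' x\<close>; multiplied by \<open>d x\<close>, the left side is
  \<open>d (f (k * x + c))\<close> and the right side \<open>\<phi>' (f x) * d (f x)\<close>.\<close>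

lemma derivation_rule_transfer:
  assumes d_additive: "Modules.additive d" and der: "derivation_wrt d f I"
    and f': "\<And>x. x \<in> I \<Longrightarrow> (f has_real_derivative f' x) (at x)"
    and J: "open J" "J \<subseteq> I" "\<And>x. x \<in> J \<Longrightarrow> k * x + c \<in> I"
    and k: "k \<in> \<rat>" and c: "d c = 0"
    and eq: "\<And>x. x \<in> J \<Longrightarrow> f (k * x + c) = \<phi> (f x)"
    and x: "x \<in> J" and \<phi>': "(\<phi> has_real_derivative D) (at (f x))"
  shows "d (\<phi> (f x)) = D * d (f x)"
proof -
  interpret additive d by fact
  have "((\<lambda>x. f (k * x + c)) has_real_derivative f' (k * x + c) * k) (at x)"
    using f'[OF J(3)[OF x]] by (rule DERIV_chain2) (auto intro!: derivative_eq_intros)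
  then have "((\<lambda>x. \<phi> (f x)) has_real_derivative f' (k * x + c) * k) (at x)"
    by (rule has_field_derivative_transform_within_open[OF _ J(1) x]) (rule eq)
  moreover have "((\<lambda>x. \<phi> (f x)) has_real_derivative D * f' x) (at x)"
    using DERIV_chain2[OF \<phi>' f'] x J(2) by auto
  ultimately have chain: "f' (k * x + c) * k = D * f' x"
    by (rule DERIV_unique)
  have "d (\<phi> (f x)) = f' (k * x + c) * (k * d x)"
    using derivation_wrtD[OF der J(3)[OF x] f'[OF J(3)[OF x]]] eq[OF x]
    by (simp add: add c additive_rat_mult[OF d_additive k])
  also have "\<dots> = D * (f' x * d x)"
    using chain by (simp add: algebra_simps)
  also have "f' x * d x = d (f x)"
    using derivation_wrtD[OF der _ f', of x] x J(2) by auto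
  finally show ?thesis .
qed

text \<open>Transferred rules hold at the values of \<open>f\<close>; the values have to fill an interval.\<close>

lemma image_contains_open_interval:
  fixes f :: "real \<Rightarrow> real"
  assumes f': "\<And>x. x \<in> {a<..<b} \<Longrightarrow> (f has_real_derivative f' x) (at x)"
    and x0: "x0 \<in> {a<..<b}" "f' x0 \<noteq> 0"
  obtains p q where "p < q" "{p<..<q} \<subseteq> f ` {a<..<b}"
proof -
  have "\<exists>x\<in>{a<..<b}. f x \<noteq> f x0"
  proof (rule ccontr)
    assume "\<not> (\<exists>x\<in>{a<..<b}. f x \<noteq> f x0)"
    then have const: "f x = f x0" if "x \<in> {a<..<b}" for x
      using that by blast
    have "((\<lambda>_. f x0) has_real_derivative f' x0) (at x0)"
      by (rule has_field_derivative_transform_within_open[OF f'[OF x0(1)] _ x0(1)])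
        (simp_all add: const)
    then show False
      using x0(2) DERIV_unique[OF _ DERIV_const] by blast
  qed
  then obtain x where x: "x \<in> {a<..<b}" "f x \<noteq> f x0" by blast
  have "continuous_on {a<..<b} f"
    using f' DERIV_isCont by (blast intro: continuous_at_imp_continuous_on)
  then have "is_interval (f ` {a<..<b})"
    by (metis connected_continuous_image connected_Ioo is_interval_connected_1)
  then have between: "{min (f x) (f x0)<..<max (f x) (f x0)} \<subseteq> f ` {a<..<b}"
    using x x0(1) unfolding is_interval_1
    by (auto simp: min_def max_def split: if_splits)
  show ?thesis
    using that[OF _ between] x(2) by (simp add: min_def max_def)
qed

text \<open>The points whose pairwise sums, in particular whose doubles, remain in \<open>(\<alpha>, \<beta>)\<close>.\<close>

definition sum_domain :: "real \<Rightarrow> real \<Rightarrow> real set" where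
  "sum_domain \<alpha> \<beta> = {max \<alpha> (\<alpha> / 2)<..<min \<beta> (\<beta> / 2)}"

lemma sum_domainD:
  assumes "x \<in> sum_domain \<alpha> \<beta>"
  shows "x \<in> {\<alpha><..<\<beta>}" "2 * x \<in> {\<alpha><..<\<beta>}" "y \<in> sum_domain \<alpha> \<beta> \<Longrightarrow> x + y \<in> {\<alpha><..<\<beta>}"
  using assms unfolding sum_domain_def by auto

lemma sum_domain_subset: "sum_domain \<alpha> \<beta> \<subseteq> {\<alpha><..<\<beta>}"
  using sum_domainD(1) by blast

lemma open_sum_domain: "open (sum_domain \<alpha> \<beta>)"
  unfolding sum_domain_def by simp

lemma sum_domain_nonempty:
  assumes "\<alpha> < \<beta>" "2 * \<alpha> < \<beta>" "\<alpha> < 2 * \<beta>"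
  obtains x where "x \<in> sum_domain \<alpha> \<beta>"
proof -
  have "max \<alpha> (\<alpha> / 2) < min \<beta> (\<beta> / 2)"
    using assms by simp
  then obtain x where "max \<alpha> (\<alpha> / 2) < x" "x < min \<beta> (\<beta> / 2)"
    using dense by blast
  then have "x \<in> sum_domain \<alpha> \<beta>"
    unfolding sum_domain_def by simp
  then show ?thesis by (rule that)
qed

lemma image_sum_domain_contains_open_interval:
  fixes f :: "real \<Rightarrow> real"
  assumes f': "\<And>x. x \<in> {\<alpha><..<\<beta>} \<Longrightarrow> (f has_real_derivative f' x) (at x)"
    and x0: "x0 \<in> sum_domain \<alpha> \<beta>" "f' x0 \<noteq> 0"
  obtains p q where "p < q" "{p<..<q} \<subseteq> f ` sum_domain \<alpha> \<beta>"
  using image_contains_open_interval[of "max \<alpha> (\<alpha> / 2)" "min \<beta> (\<beta> / 2)" f f' x0]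
    assms sum_domainD(1)[of _ \<alpha> \<beta>] unfolding sum_domain_def by metis

lemma derivation_rule_doubling:
  assumes d_additive: "Modules.additive d" and der: "derivation_wrt d f {\<alpha><..<\<beta>}"
    and f': "\<And>x. x \<in> {\<alpha><..<\<beta>} \<Longrightarrow> (f has_real_derivative f' x) (at x)"
    and eq: "\<And>x. x \<in> sum_domain \<alpha> \<beta> \<Longrightarrow> f (2 * x) = \<phi> (f x)"
    and "x \<in> sum_domain \<alpha> \<beta>" "(\<phi> has_real_derivative D) (at (f x))"
  shows "d (\<phi> (f x)) = D * d (f x)"
proof -
  interpret additive d by fact
  show ?thesis
    using assms(5,6) sum_domainD(2) eq
    by (intro derivation_rule_transfer[where k = 2 and c = 0, OF d_additive der f' open_sum_domain sum_domain_subset])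
      (auto simp: zero)
qed

section \<open>Doubling formulas: exponential, cosine and cotangent\<close>

lemma standard_derivation_if_quadratic_doubling:
  assumes d_additive: "Modules.additive d" and der: "derivation_wrt d f {\<alpha><..<\<beta>}"
    and f': "\<And>x. x \<in> {\<alpha><..<\<beta>} \<Longrightarrow> (f has_real_derivative f' x) (at x)"
    and x0: "x0 \<in> sum_domain \<alpha> \<beta>" "f' x0 \<noteq> 0"
    and k: "k \<in> \<rat>" "k \<noteq> 0"
    and eq: "\<And>x. x \<in> sum_domain \<alpha> \<beta> \<Longrightarrow> f (2 * x) = k * (f x)\<^sup>2 + c"
  shows "standard_derivation d"
proof -
  interpret additive d by fact
  obtain p q where pq: "p < q" "{p<..<q} \<subseteq> f ` sum_domain \<alpha> \<beta>"
    using image_sum_domain_contains_open_interval[OF f' x0] .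
  show ?thesis
  proof (rule standard_derivation_if_square_rule[OF d_additive pq(1)])
    fix u
    assume "u \<in> {p<..<q}"
    then obtain x where x: "x \<in> sum_domain \<alpha> \<beta>" "u = f x"
      using pq(2) by blast
    have "d (k * (f x)\<^sup>2 + c) = (k * (2 * f x)) * d (f x)"
      by (rule derivation_rule_doubling[where f' = f' and \<phi> = "\<lambda>u. k * u\<^sup>2 + c", OF d_additive der f' eq x(1)])
        (auto intro!: derivative_eq_intros)
    then have "k * d (u\<^sup>2) + d c = k * (2 * u * d u)"
      by (simp add: x add additive_rat_mult[OF d_additive k(1)])
    then show "d (u\<^sup>2) = 2 * u * d u + (- d c / k)"
      using k(2) by (simp add: field_simps)
  qed
qed

lemma standard_derivation_if_cotangent_doubling:
  assumes d_additive: "Modules.additive d" and der: "derivation_wrt d f {\<alpha><..<\<beta>}"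
    and f': "\<And>x. x \<in> {\<alpha><..<\<beta>} \<Longrightarrow> (f has_real_derivative f' x) (at x)"
    and x0: "x0 \<in> sum_domain \<alpha> \<beta>" "f' x0 \<noteq> 0"
    and \<sigma>: "\<sigma> \<in> {1, -1}"
    and eq: "\<And>x. x \<in> sum_domain \<alpha> \<beta> \<Longrightarrow> f x \<noteq> 0 \<and> f (2 * x) = (f x + \<sigma> / f x) / 2"
  shows "standard_derivation d"
proof -
  interpret additive d by fact
  obtain p q where pq: "p < q" "{p<..<q} \<subseteq> f ` sum_domain \<alpha> \<beta>"
    using image_sum_domain_contains_open_interval[OF f' x0] .
  show ?thesis
  proof (rule standard_derivation_if_reciprocal_rule[OF d_additive pq(1)])
    fix u
    assume "u \<in> {p<..<q}"
    then obtain x where x: "x \<in> sum_domain \<alpha> \<beta>" "u = f x"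
      using pq(2) by blast
    then have u: "u \<noteq> 0"
      using eq[OF x(1)] by simp
    have "((\<lambda>u. (u + \<sigma> / u) / 2) has_real_derivative ((1 - \<sigma> / u\<^sup>2) / 2)) (at u)"
      using u by (auto intro!: derivative_eq_intros simp: power2_eq_square)
    then have "d ((f x + \<sigma> / f x) / 2) = ((1 - \<sigma> / u\<^sup>2) / 2) * d (f x)"
      using derivation_rule_doubling[where f' = f' and \<phi> = "\<lambda>u. (u + \<sigma> / u) / 2", OF d_additive der f' _ x(1)] eq
      by (simp add: x(2))
    then have "d (u + \<sigma> * (1 / u)) = (1 - \<sigma> / u\<^sup>2) * d u"
      using additive_rat_divide[OF d_additive, of 2] by (simp add: x)
    moreover have "\<sigma> \<in> \<rat>"
      using \<sigma> by auto
    ultimately have "d u + \<sigma> * d (1 / u) = (1 - \<sigma> / u\<^sup>2) * d u"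
      by (metis add additive_rat_mult[OF d_additive])
    then have "\<sigma> * d (1 / u) = \<sigma> * (- d u / u\<^sup>2)"
      by (simp add: algebra_simps)
    with u \<sigma> show "u \<noteq> 0 \<and> d (1 / u) = - d u / u\<^sup>2"
      by auto
  qed
qed

section \<open>Tripling formulas: sine\<close>

lemma standard_derivation_if_sine_tripling:
  assumes d_additive: "Modules.additive d" and der: "derivation_wrt d f {\<alpha><..<\<beta>}"
    and f': "\<And>x. x \<in> {\<alpha><..<\<beta>} \<Longrightarrow> (f has_real_derivative f' x) (at x)"
    and zero_in: "\<alpha> < 0" "0 < \<beta>" and f'0: "f' 0 \<noteq> 0"
    and k: "k \<in> \<rat>" "k \<noteq> 0"
    and eq: "\<And>x. f (3 * x) = 3 * f x + k * (f x)^3"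
  shows "standard_derivation d"
proof -
  interpret additive d by fact
  have J: "{\<alpha> / 3<..<\<beta> / 3} \<subseteq> {\<alpha><..<\<beta>}"
    using zero_in by auto
  obtain p q where pq: "p < q" "{p<..<q} \<subseteq> f ` {\<alpha> / 3<..<\<beta> / 3}"
    using image_contains_open_interval[of "\<alpha> / 3" "\<beta> / 3" f f' 0] f' J zero_in f'0 by auto
  show ?thesis
  proof (rule standard_derivation_if_cube_rule[OF d_additive pq(1)])
    fix u
    assume "u \<in> {p<..<q}"
    then obtain x where x: "x \<in> {\<alpha> / 3<..<\<beta> / 3}" "u = f x"
      using pq(2) by blast
    have "((\<lambda>u. 3 * u + k * u^3) has_real_derivative 3 + k * (3 * u\<^sup>2)) (at u)"
      by (auto intro!: derivative_eq_intros)
    then have "d (3 * f x + k * (f x)^3) = (3 + k * (3 * u\<^sup>2)) * d (f x)"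
      by (intro derivation_rule_transfer[where f' = f' and \<phi> = "\<lambda>u. 3 * u + k * u^3"
            and k = 3 and c = 0, OF d_additive der f' _ J _ _ _ _ x(1)])
        (auto simp: zero eq x(2))
    then have "3 * d u + k * d (u^3) = (3 + k * (3 * u\<^sup>2)) * d u"
      using k(1) by (simp add: x(2) add additive_rat_mult[OF d_additive])
    then have "k * d (u^3) = k * (3 * u\<^sup>2 * d u)"
      by (simp add: algebra_simps)
    with k(2) show "d (u^3) = 3 * u\<^sup>2 * d u" by simp
  qed
qed

section \<open>Rational translations: tangent\<close>

text \<open>The doubling map \<open>2 u / (1 + \<sigma> u\<^sup>2)\<close> is not homogeneous of degree one, so at a nonzero rational
  \<open>u\<close> its rule is contradictory unless \<open>d 1 = 0\<close>. This makes translations by points with rational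
  \<open>f\<close>-value admissible in \<open>derivation_rule_transfer\<close>.\<close>

lemma standard_derivation_if_tangent_addition:
  assumes d_additive: "Modules.additive d" and der: "derivation_wrt d f {\<alpha><..<\<beta>}"
    and f': "\<And>x. x \<in> {\<alpha><..<\<beta>} \<Longrightarrow> (f has_real_derivative 1 - \<sigma> * (f x)\<^sup>2) (at x)"
    and nz: "\<And>x. x \<in> {\<alpha><..<\<beta>} \<Longrightarrow> 1 - \<sigma> * (f x)\<^sup>2 \<noteq> 0"
    and x0: "x0 \<in> sum_domain \<alpha> \<beta>"
    and \<sigma>: "\<sigma> \<in> {1, -1}"
    and eq: "\<And>x y. x \<in> sum_domain \<alpha> \<beta> \<Longrightarrow> y \<in> sum_domain \<alpha> \<beta> \<Longrightarrow>
      1 + \<sigma> * f x * f y \<noteq> 0 \<and> f (x + y) = (f x + f y) / (1 + \<sigma> * f x * f y)"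
  shows "standard_derivation d"
proof -
  interpret additive d by fact
  have \<sigma>_rat: "\<sigma> \<in> \<rat>" and \<sigma>2: "\<sigma> * \<sigma> = 1" and \<sigma>_nz: "\<sigma> \<noteq> 0"
    using \<sigma> by auto
  obtain p q where pq: "p < q" "{p<..<q} \<subseteq> f ` sum_domain \<alpha> \<beta>"
    using image_sum_domain_contains_open_interval[OF f' x0] nz sum_domainD(1)[OF x0] by blast
  obtain s where s: "s \<in> \<rat>" "s \<noteq> 0" "s \<in> {p<..<q}"
    using exists_nonzero_rat_between[OF pq(1)] .
  then obtain y where y: "y \<in> sum_domain \<alpha> \<beta>" "f y = s"
    using pq(2) by blast

  have s_den: "1 + \<sigma> * s\<^sup>2 \<noteq> 0"
    using eq[OF y(1) y(1)] by (simp add: y(2) power2_eq_square mult.assoc)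
  have dbl: "f (2 * x) = 2 * f x / (1 + \<sigma> * (f x)\<^sup>2)" if "x \<in> sum_domain \<alpha> \<beta>" for x
    using eq[OF that that] by (simp add: power2_eq_square mult.assoc)
  have "((\<lambda>u. 2 * u / (1 + \<sigma> * u\<^sup>2)) has_real_derivative
      2 * (1 - \<sigma> * s\<^sup>2) / (1 + \<sigma> * s\<^sup>2)\<^sup>2) (at s)"
    using s_den by (auto intro!: derivative_eq_intros simp: power2_eq_square divide_simps algebra_simps)
  then have "d (2 * s / (1 + \<sigma> * s\<^sup>2)) = 2 * (1 - \<sigma> * s\<^sup>2) / (1 + \<sigma> * s\<^sup>2)\<^sup>2 * d s"
    using derivation_rule_doubling[where f' = "\<lambda>x. 1 - \<sigma> * (f x)\<^sup>2" and \<phi> = "\<lambda>u. 2 * u / (1 + \<sigma> * u\<^sup>2)", OF d_additive der f' dbl y(1)]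
    by (simp add: y(2))
  moreover have "2 * s / (1 + \<sigma> * s\<^sup>2) \<in> \<rat>"
    using s(1) \<sigma>_rat by simp
  ultimately have "2 * s / (1 + \<sigma> * s\<^sup>2) * d 1 = 2 * (1 - \<sigma> * s\<^sup>2) / (1 + \<sigma> * s\<^sup>2)\<^sup>2 * (s * d 1)"
    using additive_rat_mult[OF d_additive, of _ 1] s(1) by (metis mult.right_neutral)
  then have "(2 * s * d 1) * (1 + \<sigma> * s\<^sup>2) = (2 * s * d 1) * (1 - \<sigma> * s\<^sup>2)"
    using s_den by (simp add: divide_simps power2_eq_square[of "1 + \<sigma> * s\<^sup>2"])
  then have "4 * \<sigma> * s^3 * d 1 = 0"
    by (simp add: algebra_simps power2_eq_square power3_eq_cube)
  then have one: "d 1 = 0"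
    using s(2) \<sigma>_nz by simp
  have y0: "d y = 0"
    using derivation_wrtD[OF der sum_domainD(1)[OF y(1)] f'[OF sum_domainD(1)[OF y(1)]]]
      nz[OF sum_domainD(1)[OF y(1)]] additive_Rats_eq_zero[OF d_additive one s(1)] y(2) by simp

  have key: "1 + \<sigma> * s * u \<noteq> 0 \<and> d (1 / (1 + \<sigma> * s * u)) = - d (1 + \<sigma> * s * u) / (1 + \<sigma> * s * u)\<^sup>2"
    if "u \<in> {p<..<q}" for u
  proof -
    obtain x where x: "x \<in> sum_domain \<alpha> \<beta>" "u = f x"
      using pq(2) \<open>u \<in> {p<..<q}\<close> by blast
    define w where "w = 1 + \<sigma> * s * u"
    have w: "w \<noteq> 0"
      using eq[OF x(1) y(1)] by (simp add: w_def x(2) y(2) algebra_simps)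
    have trans: "f (1 * z + y) = (f z + s) / (1 + \<sigma> * s * f z)" if "z \<in> sum_domain \<alpha> \<beta>" for z
      using eq[OF that y(1)] by (simp add: y(2) algebra_simps)
    have "((\<lambda>u. (u + s) / (1 + \<sigma> * s * u)) has_real_derivative (1 - \<sigma> * s\<^sup>2) / w\<^sup>2) (at u)"
      using w unfolding w_def
      by (auto intro!: derivative_eq_intros simp: power2_eq_square divide_simps algebra_simps)
    then have hom: "d ((u + s) / w) = (1 - \<sigma> * s\<^sup>2) / w\<^sup>2 * d u"
      using derivation_rule_transfer[where f' = "\<lambda>x. 1 - \<sigma> * (f x)\<^sup>2" and \<phi> = "\<lambda>u. (u + s) / (1 + \<sigma> * s * u)" and k = 1 and c = y,
          OF d_additive der f' open_sum_domain sum_domain_subset _ _ y0 trans x(1)] sum_domainD(3) y(1)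
      by (simp add: w_def x(2))
    \<comment> \<open>partial fractions in \<open>u\<close>; note \<open>\<sigma> = 1 / \<sigma>\<close>\<close>
    define \<kappa> where "\<kappa> = \<sigma> / s - s"
    have "(u + s) / w + \<kappa> * (1 / w) = \<sigma> / s"
    proof -
      have "\<sigma> * w = \<sigma> + s * u"
        using \<sigma>2 unfolding w_def by (simp add: distrib_left mult.assoc[symmetric])
      then have "u + s + \<kappa> = \<sigma> / s * w"
        using s(2) unfolding \<kappa>_def by (simp add: field_simps)
      then show ?thesis
        using w by (simp add: add_divide_distrib[symmetric])
    qed
    then have "d ((u + s) / w) + d (\<kappa> * (1 / w)) = d (\<sigma> / s)"
      by (metis add)
    moreover have "\<kappa> \<in> \<rat>" "\<sigma> / s \<in> \<rat>"
      using s(1) \<sigma>_rat unfolding \<kappa>_def by simp_all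
    ultimately have "(1 - \<sigma> * s\<^sup>2) / w\<^sup>2 * d u + \<kappa> * d (1 / w) = 0"
      using hom additive_rat_mult[OF d_additive] additive_Rats_eq_zero[OF d_additive one] by metis
    moreover have "d w = \<sigma> * s * d u"
      unfolding w_def using s(1) \<sigma>_rat by (simp add: add one additive_rat_mult[OF d_additive])
    moreover have "1 - \<sigma> * s\<^sup>2 = \<kappa> * (\<sigma> * s)"
      using s(2) \<sigma>2 unfolding \<kappa>_def by (simp add: field_simps power2_eq_square)
    ultimately have "\<kappa> * (d w / w\<^sup>2 + d (1 / w)) = 0"
      by (simp add: algebra_simps)
    moreover have "\<kappa> \<noteq> 0"
      using nz[OF sum_domainD(1)[OF y(1)]] \<open>1 - \<sigma> * s\<^sup>2 = \<kappa> * (\<sigma> * s)\<close> y(2) by auto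
    ultimately show ?thesis
      using w unfolding w_def by (simp add: eq_neg_iff_add_eq_0 add.commute)
  qed
  obtain a b where ab: "a < b" "{a<..<b} \<subseteq> (\<lambda>u. 1 + \<sigma> * s * u) ` {p<..<q}"
  proof (rule image_contains_open_interval[of p q "\<lambda>u. 1 + \<sigma> * s * u" "\<lambda>_. \<sigma> * s" s])
    show "((\<lambda>u. 1 + \<sigma> * s * u) has_real_derivative \<sigma> * s) (at x)" for x
      by (auto intro!: derivative_eq_intros)
  qed (use s \<sigma>_nz in auto)
  show ?thesis
  proof (rule standard_derivation_if_reciprocal_rule[OF d_additive ab(1)])
    fix w
    assume "w \<in> {a<..<b}"
    then obtain u where "u \<in> {p<..<q}" "w = 1 + \<sigma> * s * u"
      using ab(2) by blast
    with key show "w \<noteq> 0 \<and> d (1 / w) = - d w / w\<^sup>2"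
      by simp
  qed
qed

section \<open>The nine functions\<close>

lemma sinh_triple: "sinh (3 * x) = 3 * sinh x + 4 * sinh x ^ 3" for x :: real
proof -
  have "sinh (3 * x) = sinh (2 * x + x)"
    by (simp add: algebra_simps)
  also have "\<dots> = 2 * sinh x * (cosh x)\<^sup>2 + ((cosh x)\<^sup>2 + (sinh x)\<^sup>2) * sinh x"
    unfolding sinh_add sinh_double cosh_double by (simp add: power2_eq_square)
  also have "\<dots> = 3 * sinh x + 4 * sinh x ^ 3"
    unfolding cosh_square_eq by (simp add: power2_eq_square power3_eq_cube algebra_simps)
  finally show ?thesis .
qed

lemma sin_triple: "sin (3 * x) = 3 * sin x - 4 * sin x ^ 3" for x :: real
proof -
  have "sin (3 * x) = sin (2 * x + x)"
    by (simp add: algebra_simps)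
  also have "\<dots> = 2 * sin x * (cos x)\<^sup>2 + ((cos x)\<^sup>2 - (sin x)\<^sup>2) * sin x"
    unfolding sin_add sin_double cos_double by (simp add: power2_eq_square)
  also have "\<dots> = 3 * sin x - 4 * sin x ^ 3"
    unfolding cos_squared_eq by (simp add: power2_eq_square power3_eq_cube algebra_simps)
  finally show ?thesis .
qed

lemma standard_derivation_if_derivation_cosh:
  assumes d_additive: "Modules.additive d" and der: "derivation_wrt d cosh {\<alpha><..<\<beta>}"
    and bounds: "\<alpha> < \<beta>" "2 * \<alpha> < \<beta>" "\<alpha> < 2 * \<beta>" and "0 \<notin> {\<alpha><..<\<beta>}"
  shows "standard_derivation d"
proof -
  obtain x0 where x0: "x0 \<in> sum_domain \<alpha> \<beta>"
    using sum_domain_nonempty bounds by blast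
  then have "sinh x0 \<noteq> 0"
    using sum_domainD(1)[OF x0] assms(6) by auto
  then show ?thesis
    by (intro standard_derivation_if_quadratic_doubling
        [OF d_additive der, where f' = sinh and k = 2 and c = "-1", OF _ x0])
      (auto intro!: derivative_eq_intros simp: cosh_double_cosh)
qed

lemma standard_derivation_if_derivation_cos:
  assumes d_additive: "Modules.additive d" and der: "derivation_wrt d cos {\<alpha><..<\<beta>}"
    and x0: "x0 \<in> sum_domain \<alpha> \<beta>" "sin x0 \<noteq> 0"
  shows "standard_derivation d"
  by (rule standard_derivation_if_quadratic_doubling
      [OF d_additive der, where f' = "\<lambda>x. - sin x" and k = 2 and c = "-1", OF _ x0(1)])
    (use x0(2) in \<open>auto intro!: derivative_eq_intros simp: cos_double_cos\<close>)

lemma standard_derivation_if_derivation_coth: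
  assumes d_additive: "Modules.additive d" and der: "derivation_wrt d coth {\<alpha><..<\<beta>}"
    and bounds: "\<alpha> < \<beta>" "2 * \<alpha> < \<beta>" "\<alpha> < 2 * \<beta>" and "0 \<notin> {\<alpha><..<\<beta>}"
  shows "standard_derivation d"
proof -
  have nz: "sinh x \<noteq> 0" if "x \<in> {\<alpha><..<\<beta>}" for x
    using that assms(6) by auto
  obtain x0 where x0: "x0 \<in> sum_domain \<alpha> \<beta>"
    using sum_domain_nonempty bounds by blast
  show ?thesis
  proof (rule standard_derivation_if_cotangent_doubling[OF d_additive der, where \<sigma> = 1, OF _ x0])
    fix x
    assume "x \<in> {\<alpha><..<\<beta>}"
    from nz[OF this] show "(coth has_real_derivative - 1 / (sinh x)\<^sup>2) (at x)"
      unfolding coth_def[abs_def]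
      by (auto intro!: derivative_eq_intros simp: cosh_square_eq power2_eq_square[symmetric])
  next
    show "- 1 / (sinh x0)\<^sup>2 \<noteq> 0"
      using nz sum_domainD(1)[OF x0] by auto
  next
    fix x
    assume "x \<in> sum_domain \<alpha> \<beta>"
    then have "sinh x \<noteq> 0"
      using nz sum_domainD(1) by blast
    then show "coth x \<noteq> 0 \<and> coth (2 * x) = (coth x + 1 / coth x) / 2"
      unfolding coth_def cosh_double sinh_double by (simp add: field_simps power2_eq_square)
  qed simp
qed

lemma standard_derivation_if_derivation_cot:
  assumes d_additive: "Modules.additive d" and der: "derivation_wrt d cot {\<alpha><..<\<beta>}"
    and bounds: "\<alpha> < \<beta>" "2 * \<alpha> < \<beta>" "\<alpha> < 2 * \<beta>"
    and nz: "\<And>x. x \<in> {\<alpha><..<\<beta>} \<Longrightarrow> sin x \<noteq> 0"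
  shows "standard_derivation d"
proof -
  obtain x0 where x0: "x0 \<in> sum_domain \<alpha> \<beta>"
    using sum_domain_nonempty bounds by blast
  show ?thesis
  proof (rule standard_derivation_if_cotangent_doubling[OF d_additive der, where \<sigma> = "-1", OF _ x0])
    show "(cot has_real_derivative - inverse ((sin x)\<^sup>2)) (at x)" if "x \<in> {\<alpha><..<\<beta>}" for x
      using DERIV_cot[OF nz[OF that]] .
    show "- inverse ((sin x0)\<^sup>2) \<noteq> 0"
      using nz sum_domainD(1)[OF x0] by auto
  next
    fix x
    assume "x \<in> sum_domain \<alpha> \<beta>"
    then have "sin x \<noteq> 0" "sin (2 * x) \<noteq> 0"
      using nz sum_domainD(1,2) by blast+
    then show "cot x \<noteq> 0 \<and> cot (2 * x) = (cot x + - 1 / cot x) / 2"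
      unfolding cot_def cos_double sin_double by (simp add: field_simps power2_eq_square)
  qed simp
qed

theorem theorem7:
  fixes d :: "real \<Rightarrow> real" and \<alpha> \<beta> :: real
  assumes "Modules.additive d"
    and "\<alpha> < \<beta>"
    and "(derivation_wrt d exp {\<alpha><..<\<beta>} \<and> 2 * \<alpha> < \<beta> \<and> \<alpha> < 2 * \<beta>)
       \<or> (derivation_wrt d sinh {\<alpha><..<\<beta>} \<and> \<alpha> < 0 \<and> 0 < \<beta>)
       \<or> (derivation_wrt d cosh {\<alpha><..<\<beta>} \<and>
            ((0 < 2 * \<alpha> \<and> 2 * \<alpha> < \<beta>) \<or> (\<alpha> < 2 * \<beta> \<and> 2 * \<beta> < 0)))
       \<or> (derivation_wrt d tanh {\<alpha><..<\<beta>} \<and> \<alpha> < 0 \<and> 0 < \<beta>)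
       \<or> (derivation_wrt d coth {\<alpha><..<\<beta>} \<and>
            ((0 < 2 * \<alpha> \<and> 2 * \<alpha> < \<beta>) \<or> (\<alpha> < 2 * \<beta> \<and> 2 * \<beta> < 0)))
       \<or> (derivation_wrt d sin {\<alpha><..<\<beta>} \<and> \<alpha> < 0 \<and> 0 < \<beta>)
       \<or> (derivation_wrt d cos {\<alpha><..<\<beta>} \<and>
            ((0 < 2 * \<alpha> \<and> 2 * \<alpha> < pi \<and> pi < \<beta>) \<or> (\<alpha> < - pi \<and> - pi < 2 * \<beta> \<and> 2 * \<beta> < 0)))
       \<or> (derivation_wrt d tan {\<alpha><..<\<beta>} \<and>
            - pi < 2 * \<alpha> \<and> 2 * \<alpha> < \<beta> \<and> \<alpha> < 2 * \<beta> \<and> 2 * \<beta> < pi)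
       \<or> (derivation_wrt d cot {\<alpha><..<\<beta>} \<and>
            ((0 < 2 * \<alpha> \<and> 2 * \<alpha> < \<beta> \<and> \<beta> < pi) \<or> (- pi < \<alpha> \<and> \<alpha> < 2 * \<beta> \<and> 2 * \<beta> < 0)))"
  shows "standard_derivation d"
proof -
  note d_additive = assms(1)
  show ?thesis
    using assms(3)
  proof (elim disjE conjE)
    assume der: "derivation_wrt d exp {\<alpha><..<\<beta>}" and "2 * \<alpha> < \<beta>" "\<alpha> < 2 * \<beta>"
    then obtain x0 where x0: "x0 \<in> sum_domain \<alpha> \<beta>"
      using sum_domain_nonempty assms(2) by blast
    show ?thesis
      by (rule standard_derivation_if_quadratic_doubling
          [OF d_additive der, where f' = exp and k = 1 and c = 0, OF _ x0])
        (auto simp: exp_double)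
  next
    assume der: "derivation_wrt d sinh {\<alpha><..<\<beta>}" and "\<alpha> < 0" "0 < \<beta>"
    then show ?thesis
      by (intro standard_derivation_if_sine_tripling[OF d_additive der, where f' = cosh and k = 4])
        (auto intro!: derivative_eq_intros simp: sinh_triple)
  next
    assume "derivation_wrt d cosh {\<alpha><..<\<beta>}" "0 < 2 * \<alpha>" "2 * \<alpha> < \<beta>"
    then show ?thesis
      using assms(2) by (intro standard_derivation_if_derivation_cosh[OF d_additive]) auto
  next
    assume "derivation_wrt d cosh {\<alpha><..<\<beta>}" "\<alpha> < 2 * \<beta>" "2 * \<beta> < 0"
    then show ?thesis
      using assms(2) by (intro standard_derivation_if_derivation_cosh[OF d_additive]) auto
  next
    assume der: "derivation_wrt d tanh {\<alpha><..<\<beta>}" and "\<alpha> < 0" "0 < \<beta>"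
    then have x0: "0 \<in> sum_domain \<alpha> \<beta>"
      unfolding sum_domain_def by simp
    have den: "1 + tanh x * tanh y \<noteq> 0" for x y :: real
    proof -
      have "1 + tanh x * tanh y = cosh (x + y) / (cosh x * cosh y)"
        by (simp add: tanh_def cosh_add field_simps)
      then show ?thesis by simp
    qed
    have "(tanh x)\<^sup>2 \<noteq> 1" for x :: real
      using tanh_real_abs[of x] by (metis abs_square_less_1 less_irrefl tanh_real_lt_1 tanh_real_gt_neg1 abs_less_iff minus_less_iff)
    then show ?thesis
      by (intro standard_derivation_if_tangent_addition[OF d_additive der, where \<sigma> = 1, OF _ _ x0])
        (use den in \<open>auto intro!: derivative_eq_intros simp: tanh_add\<close>)
  next
    assume "derivation_wrt d coth {\<alpha><..<\<beta>}" "0 < 2 * \<alpha>" "2 * \<alpha> < \<beta>"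
    then show ?thesis
      using assms(2) by (intro standard_derivation_if_derivation_coth[OF d_additive]) auto
  next
    assume "derivation_wrt d coth {\<alpha><..<\<beta>}" "\<alpha> < 2 * \<beta>" "2 * \<beta> < 0"
    then show ?thesis
      using assms(2) by (intro standard_derivation_if_derivation_coth[OF d_additive]) auto
  next
    assume der: "derivation_wrt d sin {\<alpha><..<\<beta>}" and "\<alpha> < 0" "0 < \<beta>"
    then show ?thesis
      by (intro standard_derivation_if_sine_tripling[OF d_additive der, where f' = cos and k = "-4"])
        (auto intro!: derivative_eq_intros simp: sin_triple)
  next
    \<comment> \<open>As \<open>\<beta>\<close> is unbounded here, \<open>sin\<close> may vanish at some points whose double is in the interval,
      but not at \<open>pi / 2\<close>; the double of this point is \<open>pi\<close>, whence the condition \<open>pi < \<beta>\<close>.\<close>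
    assume "derivation_wrt d cos {\<alpha><..<\<beta>}" "0 < 2 * \<alpha>" "2 * \<alpha> < pi" "pi < \<beta>"
    then show ?thesis
      by (intro standard_derivation_if_derivation_cos[OF d_additive, of \<alpha> \<beta> "pi / 2"])
        (auto simp: sum_domain_def)
  next
    assume "derivation_wrt d cos {\<alpha><..<\<beta>}" "\<alpha> < - pi" "- pi < 2 * \<beta>" "2 * \<beta> < 0"
    then show ?thesis
      by (intro standard_derivation_if_derivation_cos[OF d_additive, of \<alpha> \<beta> "- (pi / 2)"])
        (auto simp: sum_domain_def)
  next
    assume der: "derivation_wrt d tan {\<alpha><..<\<beta>}"
      and bounds: "- pi < 2 * \<alpha>" "2 * \<alpha> < \<beta>" "\<alpha> < 2 * \<beta>" "2 * \<beta> < pi"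
    then obtain x0 where x0: "x0 \<in> sum_domain \<alpha> \<beta>"
      using sum_domain_nonempty assms(2) by blast
    have cos_nz: "cos x \<noteq> 0" if "x \<in> {\<alpha><..<\<beta>}" for x
      using cos_gt_zero_pi[of x] that bounds by auto
    show ?thesis
    proof (rule standard_derivation_if_tangent_addition[OF d_additive der, where \<sigma> = "-1", OF _ _ x0])
      fix x
      assume "x \<in> {\<alpha><..<\<beta>}"
      then show "(tan has_real_derivative 1 - - 1 * (tan x)\<^sup>2) (at x)"
        using DERIV_tan[OF cos_nz] tan_sec[OF cos_nz] by (simp add: power_inverse)
      show "1 - - 1 * (tan x)\<^sup>2 \<noteq> 0"
        using sum_power2_gt_zero_iff[of 1 "tan x"] by simp
    next
      fix x y
      assume xy: "x \<in> sum_domain \<alpha> \<beta>" "y \<in> sum_domain \<alpha> \<beta>"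
      have nz: "cos x \<noteq> 0" "cos y \<noteq> 0" "cos (x + y) \<noteq> 0"
        using cos_nz sum_domainD(1)[OF xy(1)] sum_domainD(1)[OF xy(2)] sum_domainD(3)[OF xy]
        by blast+
      then show "1 + - 1 * tan x * tan y \<noteq> 0 \<and> tan (x + y) = (tan x + tan y) / (1 + - 1 * tan x * tan y)"
        using lemma_tan_add1[OF nz(1,2)] tan_add[OF nz] by simp
    qed simp
  next
    assume der: "derivation_wrt d cot {\<alpha><..<\<beta>}" and bounds: "0 < 2 * \<alpha>" "2 * \<alpha> < \<beta>" "\<beta> < pi"
    have "sin x \<noteq> 0" if "x \<in> {\<alpha><..<\<beta>}" for x
      using sin_gt_zero[of x] that bounds by auto
    then show ?thesis
      using assms(2) bounds by (intro standard_derivation_if_derivation_cot[OF d_additive der]) auto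
  next
    assume der: "derivation_wrt d cot {\<alpha><..<\<beta>}" and bounds: "- pi < \<alpha>" "\<alpha> < 2 * \<beta>" "2 * \<beta> < 0"
    have "sin x \<noteq> 0" if "x \<in> {\<alpha><..<\<beta>}" for x
      using sin_gt_zero[of "- x"] that bounds by auto
    then show ?thesis
      using assms(2) bounds by (intro standard_derivation_if_derivation_cot[OF d_additive der]) auto
  qed
qed

end
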